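(* Let $r \geq 3$ and let $\mathcal{H}'$ be the $K_{r+1}^r$-decomposition of a friendship $r$-hypergraph on $n$ vertices. Then \[ |E(\mathcal{H}')| \leq \frac{2}{r(r+1)^2}\left\lfloor \frac{(r+1)(3r-4)}{6}\right\rfloor \binom{n}{r} + \frac{4}{r^2(r+1)^2}\left\lceil \frac{2(r+1)}{3} \right\rceil \binom{n}{r-1}. \]
   Context: For an $r$-uniform hypergraph $\mathcal{H}$ and a set of vertices $A$, a vertex $u \notin A$ is a friend of $A$ in $\mathcal{H}$ if for every $B \subseteq A$ with $|B| = r-1$, the set $B \cup \{u\}$ is a hyperedge of $\mathcal{H}$. An $r$-uniform hypergraph is a friendship $r$-hypergraph if every set of $r$ vertices has exactly one friend. The $K_{r+1}^r$-decomposition of $\mathcal{H}$ is the $(r+1)$-uniform hypergraph $\mathcal{H}'$ on $V(\mathcal{H})$ whose hyperedges are all $(r+1)$-subsets of $V(\mathcal{H})$ all of whose $r$-subsets are hyperedges of $\mathcal{H}$. *)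

theory Defs
  imports Complex_Main
begin

type_synonym 'a hypergraph = "'a set \<times> 'a set set"

abbreviation verts :: "'a hypergraph \<Rightarrow> 'a set" where
  "verts H \<equiv> fst H"

abbreviation hyperedges :: "'a hypergraph \<Rightarrow> 'a set set" where
  "hyperedges H \<equiv> snd H"

definition uniform_hypergraph :: "nat \<Rightarrow> 'a hypergraph \<Rightarrow> bool" where
  "uniform_hypergraph r H \<longleftrightarrow>
     finite (verts H) \<and> (\<forall>e\<in>hyperedges H. e \<subseteq> verts H \<and> card e = r)"

definition is_friend :: "nat \<Rightarrow> 'a hypergraph \<Rightarrow> 'a set \<Rightarrow> 'a \<Rightarrow> bool" where
  "is_friend r H A u \<longleftrightarrow>
     u \<in> verts H \<and> u \<notin> A \<and>
     (\<forall>B. B \<subseteq> A \<and> card B = r - 1 \<longrightarrow> B \<union> {u} \<in> hyperedges H)"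

definition friendship_hypergraph :: "nat \<Rightarrow> 'a hypergraph \<Rightarrow> bool" where
  "friendship_hypergraph r H \<longleftrightarrow>
     uniform_hypergraph r H \<and>
     (\<forall>A. A \<subseteq> verts H \<and> card A = r \<longrightarrow> (\<exists>!u. is_friend r H A u))"

definition clique_decomposition :: "nat \<Rightarrow> 'a hypergraph \<Rightarrow> 'a hypergraph" where
  "clique_decomposition r H =
     (verts H,
      {e. e \<subseteq> verts H \<and> card e = r + 1 \<and>
          (\<forall>f. f \<subseteq> e \<and> card f = r \<longrightarrow> f \<in> hyperedges H)})"

end

theory Submission
  imports Defs
begin

text \<open>
  Write \<open>a(C)\<close> for the number of edges through an \<open>(r - 1)\<close>-set \<open>C\<close> and \<open>e(S)\<close> for the number of
  edges inside an \<open>(r + 1)\<close>-set \<open>S\<close>. Counting pairs of edges that share \<open>r - 1\<close> vertices gives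
  \<open>\<Sum> a(C) (a(C) - 1) = \<Sum> e(S) (e(S) - 1)\<close>. By uniqueness of friends, every edge lies in exactly one
  hyperedge of the decomposition (so \<open>a(C)\<close> is even), and there are at most as many sets with
  \<open>e(S) = r\<close> as there are non-edges; all other \<open>S\<close> outside the decomposition have \<open>e(S) \<le> r - 1\<close>.
  This bounds the right-hand side linearly in the number of edges, while the left-hand side is
  bounded below by convexity, through \<open>(a(C) - p) (a(C) - q) \<ge> 0\<close> with \<open>p = q\<close> equal to the claimed
  upper bound for the average of \<open>a(C)\<close>. The resulting quadratic inequality suffices except for
  \<open>n \<le> r + 2\<close> and for \<open>r = 4\<close>, \<open>n \<in> {7, 8}\<close>, where the evenness of \<open>a(C)\<close> is needed.
\<close>

section \<open>Subsets of fixed size and double counting\<close>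

definition subsets_of_size :: "'a set \<Rightarrow> nat \<Rightarrow> 'a set set" where
  "subsets_of_size V k = {C. C \<subseteq> V \<and> card C = k}"

lemma subsets_of_sizeD:
  assumes "finite V" "C \<in> subsets_of_size V k"
  shows "C \<subseteq> V" "card C = k" "finite C"
  using assms finite_subset by (auto simp: subsets_of_size_def)

lemma finite_subsets_of_size [simp]: "finite V \<Longrightarrow> finite (subsets_of_size V k)"
  by (rule finite_subset[of _ "Pow V"]) (auto simp: subsets_of_size_def)

lemma card_subsets_of_size: "finite V \<Longrightarrow> card (subsets_of_size V k) = card V choose k"
  unfolding subsets_of_size_def by (rule n_subsets)

text \<open>Pairs \<open>(C, x)\<close> with \<open>x\<close> outside \<open>C\<close> correspond to
  pairs \<open>(S, x)\<close> with \<open>x\<close> in \<open>S\<close> through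
  \<open>S = insert x C\<close>. All double counts below are instances of this reindexing.\<close>

lemma sum_insert_eq_sum_remove:
  fixes g :: "'a set \<Rightarrow> 'a \<Rightarrow> 'b :: comm_monoid_add"
  assumes V: "finite V"
  shows "(\<Sum>C\<in>subsets_of_size V k. \<Sum>x\<in>V - C. g C x) =
         (\<Sum>S\<in>subsets_of_size V (Suc k). \<Sum>x\<in>S. g (S - {x}) x)"
proof -
  have "(\<Sum>C\<in>subsets_of_size V k. \<Sum>x\<in>V - C. g C x) =
        (\<Sum>(C, x)\<in>Sigma (subsets_of_size V k) (\<lambda>C. V - C). g C x)"
    using V by (subst sum.Sigma) auto
  also have "\<dots> = (\<Sum>(S, x)\<in>Sigma (subsets_of_size V (Suc k)) (\<lambda>S. S). g (S - {x}) x)"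
    by (rule sum.reindex_bij_witness
          [where i = "\<lambda>(S, x). (S - {x}, x)" and j = "\<lambda>(C, x). (insert x C, x)"])
       (auto simp: subsets_of_size_def insert_absorb card_insert_if finite_subset[OF _ V]
             intro: arg_cong2[where f = g])
  also have "\<dots> = (\<Sum>S\<in>subsets_of_size V (Suc k). \<Sum>x\<in>S. g (S - {x}) x)"
    using V subsets_of_sizeD(3)[OF V] by (subst sum.Sigma) auto
  finally show ?thesis .
qed

lemma card_filter_eq_sum:
  "finite X \<Longrightarrow> real (card {x \<in> X. P x}) = (\<Sum>x\<in>X. of_bool (P x))"
  by (simp add: Int_def)

lemma card_pred_subset_eq_remove:
  assumes "finite A" "B \<subseteq> A" "Suc (card B) = card A"
  obtains x where "x \<in> A" "B = A - {x}"
proof -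
  have "card (A - B) = 1"
    using assms by (simp add: card_Diff_subset finite_subset)
  then obtain x where "A - B = {x}" by (auto simp: card_1_singleton_iff)
  then show thesis using assms(2) by (intro that[of x]) auto
qed

text \<open>The \<open>a(C)\<close> of the overview; \<open>facet_count\<close> below is its
  \<open>e(S)\<close>. Both count vertices rather than edges, so that their sums are sums over pairs
  of a set and a vertex, ready for \<open>sum_insert_eq_sum_remove\<close>.\<close>

definition link_degree :: "'a set \<Rightarrow> 'a set set \<Rightarrow> 'a set \<Rightarrow> nat" where
  "link_degree V E C = card {x \<in> V - C. insert x C \<in> E}"

definition facet_count :: "'a set set \<Rightarrow> 'a set \<Rightarrow> nat" where
  "facet_count E S = card {x \<in> S. S - {x} \<in> E}"

lemma sum_link_degree:
  assumes V: "finite V" and E: "E \<subseteq> subsets_of_size V (Suc k)"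
  shows "(\<Sum>C\<in>subsets_of_size V k. real (link_degree V E C)) = real (Suc k) * real (card E)"
proof -
  have "(\<Sum>C\<in>subsets_of_size V k. real (link_degree V E C)) =
        (\<Sum>C\<in>subsets_of_size V k. \<Sum>x\<in>V - C. of_bool (insert x C \<in> E))"
    unfolding link_degree_def using V by (simp only: card_filter_eq_sum finite_Diff)
  also have "\<dots> = (\<Sum>S\<in>subsets_of_size V (Suc k). \<Sum>x\<in>S. of_bool (insert x (S - {x}) \<in> E))"
    by (rule sum_insert_eq_sum_remove[OF V])
  also have "\<dots> = (\<Sum>S\<in>subsets_of_size V (Suc k). real (Suc k) * of_bool (S \<in> E))"
    by (intro sum.cong refl) (auto simp: insert_absorb subsets_of_size_def)
  also have "\<dots> = real (Suc k) * real (card {S \<in> subsets_of_size V (Suc k). S \<in> E})"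
    using V by (simp only: card_filter_eq_sum finite_subsets_of_size sum_distrib_left)
  also have "{S \<in> subsets_of_size V (Suc k). S \<in> E} = E"
    using E by blast
  finally show ?thesis .
qed

lemma sum_facet_count:
  assumes V: "finite V" and E: "E \<subseteq> subsets_of_size V k"
  shows "(\<Sum>S\<in>subsets_of_size V (Suc k). real (facet_count E S)) =
         (real (card V) - real k) * real (card E)"
proof -
  have "(\<Sum>S\<in>subsets_of_size V (Suc k). real (facet_count E S)) =
        (\<Sum>S\<in>subsets_of_size V (Suc k). \<Sum>x\<in>S. of_bool (S - {x} \<in> E))"
    unfolding facet_count_def using subsets_of_sizeD(3)[OF V]
    by (intro sum.cong refl card_filter_eq_sum) auto
  also have "\<dots> = (\<Sum>A\<in>subsets_of_size V k. \<Sum>x\<in>V - A. of_bool (A \<in> E))"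
    by (rule sum_insert_eq_sum_remove[OF V, symmetric])
  also have "\<dots> = (\<Sum>A\<in>subsets_of_size V k. (real (card V) - real k) * of_bool (A \<in> E))"
    using V by (intro sum.cong refl)
      (auto simp: subsets_of_size_def card_Diff_subset finite_subset card_mono of_nat_diff)
  also have "\<dots> = (real (card V) - real k) * real (card {A \<in> subsets_of_size V k. A \<in> E})"
    using V by (simp only: card_filter_eq_sum finite_subsets_of_size sum_distrib_left)
  also have "{A \<in> subsets_of_size V k. A \<in> E} = E"
    using E by blast
  finally show ?thesis .
qed

text \<open>Ordered pairs of distinct elements satisfying \<open>P\<close>: each of the
  \<open>c\<close> choices for \<open>x\<close> leaves \<open>c - 1\<close> for \<open>y\<close>.
  The subtraction is real, so \<open>c = 0\<close> suffers no truncation.\<close>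

lemma sum_of_bool_pairs:
  assumes "finite X"
  shows "(\<Sum>x\<in>X. of_bool (P x) * (\<Sum>y\<in>X - {x}. of_bool (P y))) =
         real (card {x \<in> X. P x}) * (real (card {x \<in> X. P x}) - 1)"
proof -
  let ?c = "real (card {x \<in> X. P x})"
  have "(\<Sum>x\<in>X. of_bool (P x) * (\<Sum>y\<in>X - {x}. of_bool (P y))) =
        (\<Sum>x\<in>X. of_bool (P x) * (?c - 1))"
  proof (intro sum.cong refl)
    fix x assume "x \<in> X"
    then have "?c = of_bool (P x) + (\<Sum>y\<in>X - {x}. of_bool (P y))"
      using assms by (simp only: card_filter_eq_sum sum.remove)
    then show "of_bool (P x) * (\<Sum>y\<in>X - {x}. of_bool (P y)) = of_bool (P x) * (?c - 1)"
      by (cases "P x") auto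
  qed
  also have "\<dots> = ?c * (?c - 1)"
    using assms by (simp only: card_filter_eq_sum sum_distrib_right)
  finally show ?thesis .
qed

text \<open>Both sides count the ordered pairs of distinct edges meeting in \<open>k\<close> vertices,
  by their intersection and by their union respectively.\<close>

lemma sum_link_degree_pairs_eq_sum_facet_pairs:
  assumes V: "finite V"
  shows "(\<Sum>C\<in>subsets_of_size V k. real (link_degree V E C) * (real (link_degree V E C) - 1)) =
         (\<Sum>S\<in>subsets_of_size V (Suc (Suc k)).
            real (facet_count E S) * (real (facet_count E S) - 1))"
proof -
  have "(\<Sum>C\<in>subsets_of_size V k. real (link_degree V E C) * (real (link_degree V E C) - 1)) =
        (\<Sum>C\<in>subsets_of_size V k. \<Sum>x\<in>V - C.
           of_bool (insert x C \<in> E) * (\<Sum>y\<in>V - C - {x}. of_bool (insert y C \<in> E)))"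
    unfolding link_degree_def using V by (intro sum.cong refl sum_of_bool_pairs[symmetric]) auto
  \<comment> \<open>The two edges are \<open>C\<close> plus \<open>x\<close> and \<open>C\<close>
    plus \<open>y\<close>. First \<open>A = insert x C\<close> replaces \<open>C\<close>; after the
    sums are exchanged, \<open>S = insert y A\<close> replaces \<open>A\<close>, and the edges
    become \<open>S - {y}\<close> and \<open>S - {x}\<close>.\<close>
  also have "\<dots> = (\<Sum>A\<in>subsets_of_size V (Suc k). \<Sum>x\<in>A. of_bool (insert x (A - {x}) \<in> E) *
                    (\<Sum>y\<in>V - (A - {x}) - {x}. of_bool (insert y (A - {x}) \<in> E)))"
    by (rule sum_insert_eq_sum_remove[OF V])
  also have "\<dots> = (\<Sum>A\<in>subsets_of_size V (Suc k). \<Sum>x\<in>A. \<Sum>y\<in>V - A.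
                    of_bool (A \<in> E) * of_bool (insert y (A - {x}) \<in> E))"
  proof (intro sum.cong refl)
    fix A x assume "A \<in> subsets_of_size V (Suc k)" "x \<in> A"
    then have "insert x (A - {x}) = A" "V - (A - {x}) - {x} = V - A" by auto
    then show "of_bool (insert x (A - {x}) \<in> E) *
                 (\<Sum>y\<in>V - (A - {x}) - {x}. of_bool (insert y (A - {x}) \<in> E)) =
               (\<Sum>y\<in>V - A. of_bool (A \<in> E) * of_bool (insert y (A - {x}) \<in> E) :: real)"
      by (simp only: sum_distrib_left)
  qed
  also have "\<dots> = (\<Sum>A\<in>subsets_of_size V (Suc k). \<Sum>y\<in>V - A.
                    of_bool (A \<in> E) * (\<Sum>x\<in>A. of_bool (insert y (A - {x}) \<in> E)))"
    by (subst sum.swap) (simp only: sum_distrib_left)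
  also have "\<dots> = (\<Sum>S\<in>subsets_of_size V (Suc (Suc k)). \<Sum>y\<in>S. of_bool (S - {y} \<in> E) *
                    (\<Sum>x\<in>S - {y}. of_bool (insert y (S - {y} - {x}) \<in> E)))"
    by (rule sum_insert_eq_sum_remove[OF V])
  also have "\<dots> = (\<Sum>S\<in>subsets_of_size V (Suc (Suc k)). \<Sum>y\<in>S. of_bool (S - {y} \<in> E) *
                    (\<Sum>x\<in>S - {y}. of_bool (S - {x} \<in> E)))"
  proof (intro sum.cong refl arg_cong2[where f = "(*)"])
    fix S :: "'a set" and x y assume "y \<in> S" "x \<in> S - {y}"
    then have "insert y (S - {y} - {x}) = S - {x}" by auto
    then show "of_bool (insert y (S - {y} - {x}) \<in> E) = (of_bool (S - {x} \<in> E) :: real)"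
      by (simp only:)
  qed
  also have "\<dots> = (\<Sum>S\<in>subsets_of_size V (Suc (Suc k)).
            real (facet_count E S) * (real (facet_count E S) - 1))"
    unfolding facet_count_def using subsets_of_sizeD(3)[OF V]
    by (intro sum.cong refl sum_of_bool_pairs) auto
  finally show ?thesis .
qed


lemma choose_absorb_pred:
  fixes n k :: nat
  assumes "1 \<le> k" "k \<le> n"
  shows "real k * real (n choose k) = (real n - real k + 1) * real (n choose (k - 1))"
proof -
  have "Suc (k - 1) * (n choose Suc (k - 1)) = (n - (k - 1)) * (n choose (k - 1))"
    by (metis binomial_absorb_comp binomial_absorption)
  then have "real k * real (n choose k) = real (n - (k - 1)) * real (n choose (k - 1))"
    using assms(1) unfolding of_nat_mult[symmetric] by (cases k) auto
  also have "real (n - (k - 1)) = real n - real k + 1"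
    using assms by (simp add: of_nat_diff)
  finally show ?thesis .
qed

section \<open>Friends, blocks, and the partition of the edges by blocks\<close>

locale friendship =
  fixes r :: nat and H :: "'a hypergraph"
  assumes rank_pos: "r \<ge> 1" and friendship: "friendship_hypergraph r H"
begin

abbreviation blocks :: "'a set set" where
  "blocks \<equiv> hyperedges (clique_decomposition r H)"

lemma finite_verts: "finite (verts H)"
  using friendship by (simp add: friendship_hypergraph_def uniform_hypergraph_def)

lemma edges_subset: "hyperedges H \<subseteq> subsets_of_size (verts H) r"
  using friendship
  by (auto simp: friendship_hypergraph_def uniform_hypergraph_def subsets_of_size_def)

lemma finite_edges: "finite (hyperedges H)"
  using edges_subset finite_verts finite_subset finite_subsets_of_size by blast

lemma ex1_friend: "A \<in> subsets_of_size (verts H) r \<Longrightarrow> \<exists>!u. is_friend r H A u"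
  using friendship by (simp add: friendship_hypergraph_def subsets_of_size_def)

lemma blocks_subset: "blocks \<subseteq> subsets_of_size (verts H) (Suc r)"
  by (auto simp: clique_decomposition_def subsets_of_size_def)

lemma finite_blocks: "finite blocks"
  using blocks_subset finite_verts finite_subset finite_subsets_of_size by blast

lemma remove_in_edges:
  assumes "S \<in> blocks" "x \<in> S"
  shows "S - {x} \<in> hyperedges H"
  using assms finite_subset[OF _ finite_verts]
  by (auto simp: clique_decomposition_def)

lemma in_blocks_iff:
  assumes "S \<in> subsets_of_size (verts H) (Suc r)"
  shows "S \<in> blocks \<longleftrightarrow> (\<forall>x\<in>S. S - {x} \<in> hyperedges H)"
proof
  assume all: "\<forall>x\<in>S. S - {x} \<in> hyperedges H"
  have S: "finite S" "S \<subseteq> verts H" "card S = Suc r"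
    using subsets_of_sizeD[OF finite_verts assms] by auto
  have "f \<in> hyperedges H" if "f \<subseteq> S" "card f = r" for f
    using card_pred_subset_eq_remove[of S f] that S all by metis
  then show "S \<in> blocks"
    using S by (simp add: clique_decomposition_def)
qed (use remove_in_edges in blast)

lemma is_friend_iff:
  assumes "A \<in> subsets_of_size (verts H) r"
  shows "is_friend r H A u \<longleftrightarrow>
    u \<in> verts H - A \<and> (\<forall>x\<in>A. insert u (A - {x}) \<in> hyperedges H)"
proof -
  have A: "finite A" "A \<subseteq> verts H" "card A = r"
    using subsets_of_sizeD[OF finite_verts assms] by auto
  have "(\<forall>B. B \<subseteq> A \<and> card B = r - 1 \<longrightarrow> B \<union> {u} \<in> hyperedges H) \<longleftrightarrow>
        (\<forall>x\<in>A. insert u (A - {x}) \<in> hyperedges H)" (is "?L \<longleftrightarrow> ?R")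
  proof
    assume L: ?L
    show ?R
    proof
      fix x assume "x \<in> A"
      then have "A - {x} \<subseteq> A \<and> card (A - {x}) = r - 1" using A by auto
      with L have "(A - {x}) \<union> {u} \<in> hyperedges H" by blast
      then show "insert u (A - {x}) \<in> hyperedges H" by simp
    qed
  next
    assume R: ?R
    show ?L
    proof (intro allI impI)
      fix B assume B: "B \<subseteq> A \<and> card B = r - 1"
      then have "Suc (card B) = card A" using A rank_pos by simp
      then obtain x where "x \<in> A" "B = A - {x}"
        using card_pred_subset_eq_remove A B by metis
      then show "B \<union> {u} \<in> hyperedges H" using R by simp
    qed
  qed
  then show ?thesis by (auto simp: is_friend_def)
qed

text \<open>The facets of \<open>insert u A\<close> are \<open>A\<close> and the sets
  \<open>insert u (A - {x})\<close>. The latter are exactly what friendship asks for, and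
  \<open>A\<close> is an edge by assumption, so the friends of an edge are the vertices completing
  it to a block.\<close>

lemma insert_in_blocks_iff:
  assumes A: "A \<in> hyperedges H"
  shows "u \<notin> A \<and> insert u A \<in> blocks \<longleftrightarrow> is_friend r H A u"
proof -
  have A': "A \<in> subsets_of_size (verts H) r" using A edges_subset by blast
  have fA: "finite A" "A \<subseteq> verts H" "card A = r"
    using subsets_of_sizeD[OF finite_verts A'] by auto
  show ?thesis
  proof (cases "u \<in> verts H - A")
    case True
    then have S: "insert u A \<in> subsets_of_size (verts H) (Suc r)"
      using fA by (simp add: subsets_of_size_def)
    have "insert u A - {x} = insert u (A - {x})" if "x \<in> A" for x
      using that True by auto
    then show ?thesis
      using True A unfolding in_blocks_iff[OF S] is_friend_iff[OF A'] by simp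
  next
    case False
    then show ?thesis
      using blocks_subset by (auto simp: is_friend_def subsets_of_size_def)
  qed
qed

lemma ex1_insert_in_blocks:
  assumes "A \<in> hyperedges H"
  shows "\<exists>!u. u \<notin> A \<and> insert u A \<in> blocks"
  using ex1_friend assms edges_subset unfolding insert_in_blocks_iff[OF assms] by blast

text \<open>A block containing \<open>A\<close> has exactly one further vertex, so uniqueness of the
  completing vertex becomes uniqueness of the block.\<close>

lemma ex1_block:
  assumes A: "A \<in> hyperedges H"
  shows "\<exists>!S. S \<in> blocks \<and> A \<subseteq> S"
proof -
  obtain u where u: "u \<notin> A" "insert u A \<in> blocks"
    and uniq: "\<And>v. v \<notin> A \<Longrightarrow> insert v A \<in> blocks \<Longrightarrow> v = u"
    using ex1_insert_in_blocks[OF A] by blast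
  show ?thesis
  proof (rule ex1I[of _ "insert u A"])
    fix S assume S: "S \<in> blocks \<and> A \<subseteq> S"
    have "finite S" "card S = Suc r"
      using S blocks_subset subsets_of_sizeD[OF finite_verts] by blast+
    moreover have "card A = r" using A edges_subset subsets_of_sizeD[OF finite_verts] by blast
    ultimately obtain v where v: "v \<in> S" "A = S - {v}"
      using card_pred_subset_eq_remove S by metis
    then have "insert v A = S" by auto
    with v S uniq[of v] show "S = insert u A" by auto
  qed (use u in auto)
qed

text \<open>By \<open>ex1_block\<close> the facet families of the blocks, with \<open>r + 1\<close>
  members each, partition the edges. This turns a bound on the number of edges into one on the
  number of blocks.\<close>

lemma card_edges: "card (hyperedges H) = Suc r * card blocks"
proof -
  have fin: "finite S \<and> card S = Suc r" if "S \<in> blocks" for S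
    using that blocks_subset subsets_of_sizeD[OF finite_verts] by blast
  have "hyperedges H = (\<Union>S\<in>blocks. (\<lambda>x. S - {x}) ` S)"
  proof (intro equalityI subsetI)
    fix A assume "A \<in> hyperedges H"
    then obtain u where u: "u \<notin> A" "insert u A \<in> blocks"
      using ex1_insert_in_blocks by blast
    then have "A = insert u A - {u}" by simp
    with u show "A \<in> (\<Union>S\<in>blocks. (\<lambda>x. S - {x}) ` S)" by blast
  qed (use remove_in_edges in blast)
  moreover have "card (\<Union>S\<in>blocks. (\<lambda>x. S - {x}) ` S) = (\<Sum>S\<in>blocks. card ((\<lambda>x. S - {x}) ` S))"
  proof (rule card_UN_disjoint[OF finite_blocks])
    show "\<forall>S\<in>blocks. \<forall>T\<in>blocks. S \<noteq> T \<longrightarrow> (\<lambda>x. S - {x}) ` S \<inter> (\<lambda>x. T - {x}) ` T = {}"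
    proof (intro ballI impI, rule ccontr)
      fix S T assume ST: "S \<in> blocks" "T \<in> blocks" "S \<noteq> T"
        and "(\<lambda>x. S - {x}) ` S \<inter> (\<lambda>x. T - {x}) ` T \<noteq> {}"
      then obtain x y where "x \<in> S" "S - {x} = T - {y}" by blast
      with ex1_block[OF remove_in_edges[of S x]] ST show False by blast
    qed
  qed (use fin in blast)
  moreover have "card ((\<lambda>x. S - {x}) ` S) = Suc r" if "S \<in> blocks" for S
  proof -
    have "inj_on (\<lambda>x. S - {x}) S" by (rule inj_onI) blast
    then show ?thesis using fin[OF that] by (simp add: card_image)
  qed
  ultimately show ?thesis by simp
qed

text \<open>The blocks through an \<open>(r - 1)\<close>-set \<open>C\<close> partition the link of \<open>C\<close> into pairs.\<close>

lemma even_link_degree: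
  assumes C: "C \<in> subsets_of_size (verts H) (r - 1)"
  shows "even (link_degree (verts H) (hyperedges H) C)"
proof -
  let ?B = "{S \<in> blocks. C \<subseteq> S}"
  have fC: "finite C" "C \<subseteq> verts H" "card C = r - 1"
    using subsets_of_sizeD[OF finite_verts C] by auto
  have fin: "finite S \<and> S \<subseteq> verts H \<and> card S = Suc r" if "S \<in> blocks" for S
    using that blocks_subset subsets_of_sizeD[OF finite_verts] by blast
  have two: "card (S - C) = 2" if "S \<in> ?B" for S
    using that fin[of S] fC rank_pos by (simp add: card_Diff_subset)
  have ins: "insert x C \<in> hyperedges H" if S: "S \<in> ?B" and x: "x \<in> S - C" for S x
  proof -
    have "insert x C \<subseteq> S" "Suc (card (insert x C)) = card S"
      using S x fC fin[of S] rank_pos by auto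
    then obtain y where "y \<in> S" "insert x C = S - {y}"
      using card_pred_subset_eq_remove[of S "insert x C"] fin[of S] S by blast
    then show ?thesis using remove_in_edges S by simp
  qed
  have "{x \<in> verts H - C. insert x C \<in> hyperedges H} = (\<Union>S\<in>?B. S - C)"
  proof (intro equalityI subsetI)
    fix x assume x: "x \<in> {x \<in> verts H - C. insert x C \<in> hyperedges H}"
    then obtain S where "S \<in> blocks" "insert x C \<subseteq> S" using ex1_block by blast
    with x show "x \<in> (\<Union>S\<in>?B. S - C)" by blast
  qed (use ins fin in blast)
  moreover have "card (\<Union>S\<in>?B. S - C) = (\<Sum>S\<in>?B. card (S - C))"
  proof (rule card_UN_disjoint)
    \<comment> \<open>A vertex \<open>x\<close> common to two of these differences would put the
      edge \<open>insert x C\<close> into two blocks.\<close>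
    show "\<forall>S\<in>?B. \<forall>T\<in>?B. S \<noteq> T \<longrightarrow> (S - C) \<inter> (T - C) = {}"
    proof (intro ballI impI, rule ccontr)
      fix S T assume ST: "S \<in> ?B" "T \<in> ?B" "S \<noteq> T" and "(S - C) \<inter> (T - C) \<noteq> {}"
      then obtain x where "x \<in> S - C" "x \<in> T - C" by blast
      with ex1_block[OF ins[of S x]] ST show False by blast
    qed
  qed (use finite_blocks fin in auto)
  ultimately show ?thesis using two by (simp add: link_degree_def)
qed

lemma link_degree_le:
  assumes C: "C \<in> subsets_of_size (verts H) (r - 1)"
  shows "link_degree (verts H) (hyperedges H) C \<le> card (verts H) - (r - 1)"
proof -
  have "link_degree (verts H) (hyperedges H) C \<le> card (verts H - C)"
    unfolding link_degree_def using finite_verts by (intro card_mono) auto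
  then show ?thesis
    using subsets_of_sizeD[OF finite_verts C] by (simp add: card_Diff_subset)
qed

section \<open>Facet counts of \<open>(r + 1)\<close>-sets\<close>

lemma facet_count_le:
  assumes "S \<in> subsets_of_size (verts H) (Suc r)"
  shows "facet_count (hyperedges H) S \<le> Suc r"
  using card_mono[of S "{x \<in> S. S - {x} \<in> hyperedges H}"] subsets_of_sizeD[OF finite_verts assms]
  by (simp add: facet_count_def)

lemma facet_count_eq_Suc_iff:
  assumes S: "S \<in> subsets_of_size (verts H) (Suc r)"
  shows "facet_count (hyperedges H) S = Suc r \<longleftrightarrow> S \<in> blocks"
proof -
  have f: "finite S" "card S = Suc r" using subsets_of_sizeD[OF finite_verts S] by auto
  have "facet_count (hyperedges H) S = Suc r \<longleftrightarrow> {x \<in> S. S - {x} \<in> hyperedges H} = S"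
    unfolding facet_count_def using f card_subset_eq[of S "{x \<in> S. S - {x} \<in> hyperedges H}"] by auto
  then show ?thesis unfolding in_blocks_iff[OF S] by blast
qed

text \<open>A set with exactly one missing facet is determined by that facet, as the remaining vertex
  is its friend.\<close>

lemma card_one_missing_facet_le:
  "card {S \<in> subsets_of_size (verts H) (Suc r). facet_count (hyperedges H) S = r}
     \<le> (card (verts H) choose r) - card (hyperedges H)" (is "card ?Q \<le> _")
proof -
  let ?V = "verts H" and ?E = "hyperedges H"
  have ex: "\<exists>u. u \<in> S \<and> S - {u} \<in> subsets_of_size ?V r - ?E \<and> is_friend r H (S - {u}) u"
    if S: "S \<in> ?Q" for S
  proof -
    have f: "finite S" "S \<subseteq> ?V" "card S = Suc r"
      using S subsets_of_sizeD[OF finite_verts] by blast+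
    have "Suc (card {x \<in> S. S - {x} \<in> ?E}) = card S"
      using S f by (simp add: facet_count_def)
    then obtain u where u: "u \<in> S" "{x \<in> S. S - {x} \<in> ?E} = S - {u}"
      using card_pred_subset_eq_remove[of S "{x \<in> S. S - {x} \<in> ?E}"] f by auto
    have Su: "S - {u} \<in> subsets_of_size ?V r"
      using u(1) f by (auto simp: subsets_of_size_def)
    have "insert u (S - {u} - {x}) \<in> ?E" if "x \<in> S - {u}" for x
    proof -
      have "insert u (S - {u} - {x}) = S - {x}" using that u(1) by auto
      moreover have "x \<in> {x \<in> S. S - {x} \<in> ?E}" unfolding u(2) by (rule that)
      ultimately show ?thesis by simp
    qed
    then have "is_friend r H (S - {u}) u"
      unfolding is_friend_iff[OF Su] using u(1) f(2) by blast
    moreover have "u \<notin> {x \<in> S. S - {x} \<in> ?E}" unfolding u(2) by simp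
    ultimately show ?thesis using u(1) Su by blast
  qed
  define w where
    "w S = (SOME u. u \<in> S \<and> S - {u} \<in> subsets_of_size ?V r - ?E \<and> is_friend r H (S - {u}) u)" for S
  have w: "w S \<in> S \<and> S - {w S} \<in> subsets_of_size ?V r - ?E \<and> is_friend r H (S - {w S}) (w S)"
    if "S \<in> ?Q" for S
    unfolding w_def using ex[OF that] by (rule someI_ex)
  have "inj_on (\<lambda>S. S - {w S}) ?Q"
  proof (rule inj_onI)
    fix S T assume S: "S \<in> ?Q" and T: "T \<in> ?Q" and eq: "S - {w S} = T - {w T}"
    have "w S = w T"
    proof (rule ex1E[OF ex1_friend[of "S - {w S}"]])
      show "S - {w S} \<in> subsets_of_size ?V r" using w[OF S] by blast
    next
      fix u assume "\<forall>v. is_friend r H (S - {w S}) v \<longrightarrow> v = u"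
      then show "w S = w T" using w[OF S] w[OF T] eq by metis
    qed
    then show "S = T" using insert_Diff[of "w S" S] insert_Diff[of "w T" T] w[OF S] w[OF T] eq by metis
  qed
  then have "card ?Q = card ((\<lambda>S. S - {w S}) ` ?Q)" by (simp add: card_image)
  also have "\<dots> \<le> card (subsets_of_size ?V r - ?E)"
  proof (rule card_mono)
    show "(\<lambda>S. S - {w S}) ` ?Q \<subseteq> subsets_of_size ?V r - ?E" using w by blast
  qed (simp add: finite_verts)
  also have "\<dots> = (card ?V choose r) - card ?E"
    using edges_subset finite_edges
    by (simp add: card_Diff_subset card_subsets_of_size[OF finite_verts])
  finally show ?thesis .
qed

text \<open>Termwise, \<open>e (e - 1)\<close> is at most \<open>(r - 2) e\<close>, plus
  \<open>r\<close> if \<open>e = r\<close>, plus \<open>2 (r + 1)\<close> if \<open>S\<close> is a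
  block. The three sums are then controlled by \<open>sum_facet_count\<close>,
  \<open>card_one_missing_facet_le\<close> and \<open>card_edges\<close>.\<close>

lemma sum_facet_pairs_le:
  "(\<Sum>S\<in>subsets_of_size (verts H) (Suc r).
      real (facet_count (hyperedges H) S) * (real (facet_count (hyperedges H) S) - 1))
   \<le> (real r - 2) * (real (card (verts H)) - real r) * real (card (hyperedges H))
      + real r * (real (card (verts H) choose r) - real (card (hyperedges H)))
      + 2 * real (card (hyperedges H))"
proof -
  let ?V = "verts H" and ?E = "hyperedges H"
  let ?X = "subsets_of_size ?V (Suc r)"
  let ?e = "\<lambda>S. facet_count ?E S"
  have "(\<Sum>S\<in>?X. real (?e S) * (real (?e S) - 1)) \<le>
        (\<Sum>S\<in>?X. (real r - 2) * real (?e S) + real r * of_bool (?e S = r)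
                   + 2 * (real r + 1) * of_bool (S \<in> blocks))"
  proof (rule sum_mono)
    fix S assume S: "S \<in> ?X"
    \<comment> \<open>The first case uses \<open>e - 1 \<le> r - 2\<close>; in the other two the
      correction terms give equality.\<close>
    consider "?e S \<le> r - 1" "?e S \<noteq> r" "?e S \<noteq> Suc r" | "?e S = r" | "?e S = Suc r"
      using facet_count_le[OF S] by linarith
    then show "real (?e S) * (real (?e S) - 1) \<le> (real r - 2) * real (?e S)
        + real r * of_bool (?e S = r) + 2 * (real r + 1) * of_bool (S \<in> blocks)"
    proof cases
      case 1
      then have "real (?e S) - 1 \<le> real r - 2" using rank_pos by linarith
      then have "real (?e S) * (real (?e S) - 1) \<le> real (?e S) * (real r - 2)"
        by (intro mult_left_mono) auto
      then show ?thesis by (simp add: mult.commute add_increasing2)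
    next
      case 2
      have "S \<notin> blocks" using 2 facet_count_eq_Suc_iff[OF S] by simp
      with 2 show ?thesis by (simp add: algebra_simps)
    next
      case 3
      have "S \<in> blocks" using 3 facet_count_eq_Suc_iff[OF S] by simp
      with 3 show ?thesis by (simp add: algebra_simps)
    qed
  qed
  also have "\<dots> = (real r - 2) * (\<Sum>S\<in>?X. real (?e S)) + real r * real (card {S \<in> ?X. ?e S = r})
                   + 2 * (real r + 1) * real (card {S \<in> ?X. S \<in> blocks})"
    using finite_verts
    by (simp only: sum.distrib sum_distrib_left card_filter_eq_sum finite_subsets_of_size)
  also have "{S \<in> ?X. S \<in> blocks} = blocks" using blocks_subset by blast
  also have "2 * (real r + 1) * real (card blocks) = 2 * real (card ?E)"
    by (simp add: card_edges algebra_simps)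
  also have "(\<Sum>S\<in>?X. real (?e S)) = (real (card ?V) - real r) * real (card ?E)"
    by (rule sum_facet_count[OF finite_verts edges_subset])
  finally have "(\<Sum>S\<in>?X. real (?e S) * (real (?e S) - 1)) \<le>
      (real r - 2) * ((real (card ?V) - real r) * real (card ?E))
        + real r * real (card {S \<in> ?X. ?e S = r}) + 2 * real (card ?E)" .
  moreover have "real (card {S \<in> ?X. ?e S = r}) \<le> real (card ?V choose r) - real (card ?E)"
  proof -
    have "card ?E \<le> card ?V choose r"
      using card_mono[OF finite_subsets_of_size[OF finite_verts] edges_subset]
      by (simp add: card_subsets_of_size[OF finite_verts])
    then show ?thesis using card_one_missing_facet_le by linarith
  qed
  then have "real r * real (card {S \<in> ?X. ?e S = r})
      \<le> real r * (real (card ?V choose r) - real (card ?E))"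
    by (intro mult_left_mono) auto
  ultimately show ?thesis by (simp add: mult.assoc)
qed

section \<open>The average link degree and its quadratic inequality\<close>

text \<open>By \<open>sum_link_degree_eq\<close> this is the mean of \<open>a(C)\<close> over all
  \<open>(r - 1)\<close>-sets; in terms of the edge count it converts directly to the number of
  blocks.\<close>

definition avg_link_degree :: real where
  "avg_link_degree = real r * real (card (hyperedges H)) / real (card (verts H) choose (r - 1))"

lemma sum_link_degree_eq:
  "(\<Sum>C\<in>subsets_of_size (verts H) (r - 1). real (link_degree (verts H) (hyperedges H) C)) =
   real r * real (card (hyperedges H))"
  using sum_link_degree[OF finite_verts, of "hyperedges H" "r - 1"] edges_subset rank_pos by simp

lemma avg_link_degree_le:
  assumes "card (verts H) \<ge> r"
    and le: "\<And>C. C \<in> subsets_of_size (verts H) (r - 1) \<Longrightarrow>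
      real (link_degree (verts H) (hyperedges H) C) \<le> c"
  shows "avg_link_degree \<le> c"
proof -
  have "real r * real (card (hyperedges H)) \<le> real (card (verts H) choose (r - 1)) * c"
    using sum_bounded_above[of "subsets_of_size (verts H) (r - 1)"
        "\<lambda>C. real (link_degree (verts H) (hyperedges H) C)" c, OF le]
    unfolding sum_link_degree_eq card_subsets_of_size[OF finite_verts] .
  moreover have "card (verts H) choose (r - 1) > 0" using assms(1) by simp
  ultimately show ?thesis
    by (simp add: avg_link_degree_def divide_le_eq mult.commute)
qed

text \<open>Summing \<open>(a(C) - p) (a(C) - q) \<ge> 0\<close> bounds the pair count from below,
  and \<open>sum_facet_pairs_le\<close> bounds it from above. Besides \<open>p = q\<close>, the
  hypothesis admits a pair \<open>p\<close>, \<open>q\<close> with no attainable degree strictly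
  between them.\<close>

lemma avg_link_degree_ineq:
  fixes p q :: real
  assumes n: "card (verts H) \<ge> r"
    and pq: "\<And>C. C \<in> subsets_of_size (verts H) (r - 1) \<Longrightarrow>
      0 \<le> (real (link_degree (verts H) (hyperedges H) C) - p) *
           (real (link_degree (verts H) (hyperedges H) C) - q)"
  defines "m \<equiv> real (card (verts H)) - real r + 1"
  shows "real r * ((p + q) * avg_link_degree - p * q) \<le>
    ((real r - 2) * m - real r + 4) * avg_link_degree + real r * m"
proof -
  let ?V = "verts H" and ?E = "hyperedges H"
  let ?X = "subsets_of_size ?V (r - 1)"
  let ?a = "\<lambda>C. real (link_degree ?V ?E C)"
  define \<epsilon> where "\<epsilon> = real (card ?E)"
  define D where "D = real (card ?V choose (r - 1))"
  have D: "D > 0" using n by (simp add: D_def)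
  have s: "real r * \<epsilon> = avg_link_degree * D"
    using D by (simp add: avg_link_degree_def \<epsilon>_def D_def)
  have choose: "real r * real (card ?V choose r) = m * D"
    using choose_absorb_pred[OF rank_pos n] by (simp add: m_def D_def)
  have "0 \<le> (\<Sum>C\<in>?X. (?a C - p) * (?a C - q))"
    using pq by (intro sum_nonneg)
  also have "\<dots> = (\<Sum>C\<in>?X. ?a C * (?a C - 1) - (p + q - 1) * ?a C + p * q)"
    by (intro sum.cong refl) (simp add: algebra_simps)
  also have "\<dots> = (\<Sum>C\<in>?X. ?a C * (?a C - 1)) - (p + q - 1) * (real r * \<epsilon>) + D * (p * q)"
    by (simp only: sum.distrib sum_subtractf sum_link_degree_eq sum_constant
        card_subsets_of_size[OF finite_verts] \<epsilon>_def D_def flip: sum_distrib_left)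
  also have "(\<Sum>C\<in>?X. ?a C * (?a C - 1)) \<le>
      (real r - 2) * (m - 1) * \<epsilon> + real r * (real (card ?V choose r) - \<epsilon>) + 2 * \<epsilon>"
    using sum_facet_pairs_le sum_link_degree_pairs_eq_sum_facet_pairs[OF finite_verts, of ?E "r - 1"]
      rank_pos by (simp add: m_def \<epsilon>_def)
  finally have "(p + q - 1) * (real r * \<epsilon>) - D * (p * q) \<le>
      (real r - 2) * (m - 1) * \<epsilon> + real r * (real (card ?V choose r) - \<epsilon>) + 2 * \<epsilon>"
    by simp
  \<comment> \<open>The factor \<open>r\<close> makes the edge count appear only as
    \<open>r * \<epsilon> = avg_link_degree * D\<close> and turns the binomial coefficient into
    \<open>m * D\<close>, so that \<open>D\<close> cancels.\<close>
  then have "real r * ((p + q - 1) * (real r * \<epsilon>) - D * (p * q)) \<le>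
      real r * ((real r - 2) * (m - 1) * \<epsilon> + real r * (real (card ?V choose r) - \<epsilon>) + 2 * \<epsilon>)"
    by (intro mult_left_mono) auto
  also have "\<dots> = (real r - 2) * (m - 1) * (real r * \<epsilon>)
      + real r * (real r * real (card ?V choose r) - real r * \<epsilon>) + 2 * (real r * \<epsilon>)"
    by (simp add: algebra_simps)
  finally have "D * (real r * ((p + q) * avg_link_degree - p * q)) \<le>
    D * (((real r - 2) * m - real r + 4) * avg_link_degree + real r * m)"
    unfolding s choose by (simp add: algebra_simps)
  then show ?thesis using D by simp
qed

end


section \<open>Numerical estimates\<close>

lemma even_imp_two_four_product_nonneg:
  assumes "even a"
  shows "0 \<le> (real a - 2) * (real a - 4)"
proof -
  consider "a = 0" | "a = 2" | "a \<ge> 4"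
    using assms by (cases "a = 3"; cases "a = 1"; linarith?; auto)
  then show ?thesis by cases auto
qed

text \<open>The arguments of floor and ceiling add up to the integer \<open>r (r + 1) / 2\<close>,
  so the ceiling is this integer minus the floor.\<close>

lemma floor_ceiling_coefficients:
  fixes r :: nat and F G :: int
  assumes r: "r \<ge> 3"
  defines "F \<equiv> \<lfloor>(real r + 1) * (3 * real r - 4) / 6\<rfloor>" and "G \<equiv> \<lceil>2 * (real r + 1) / 3\<rceil>"
  shows "2 * (real_of_int F + real_of_int G) = real r * (real r + 1)"
    and "3 * (real r)\<^sup>2 - real r - 8 \<le> 6 * real_of_int F"
    and "r = 3 \<Longrightarrow> F = 3" "r = 4 \<Longrightarrow> F = 6" "r = 5 \<Longrightarrow> F = 11" "r = 6 \<Longrightarrow> F = 16"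
proof -
  define x K where "x = 3 * (int r)\<^sup>2 - int r - 4" and "K = int r * (int r + 1) div 2"
  have K2: "2 * K = int r * (int r + 1)" by (simp add: K_def)
  have x: "(real r + 1) * (3 * real r - 4) / 6 = real_of_int x / real_of_int 6"
    by (simp add: x_def algebra_simps power2_eq_square)
  have F: "F = x div 6" unfolding F_def x by (rule floor_divide_of_int_eq)
  have K: "2 * real_of_int K = real r * (real r + 1)"
    using arg_cong[OF K2, of real_of_int] by simp
  have "2 * (real r + 1) / 3 = real_of_int K - (real r + 1) * (3 * real r - 4) / 6"
    using K by (simp add: field_simps)
  then have "G = K - F" unfolding G_def F_def by (simp only: ceiling_def) linarith
  then show "2 * (real_of_int F + real_of_int G) = real r * (real r + 1)"
    using K by simp
  have "x = 3 * (2 * K) - 4 * int r - 4"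
    unfolding K2 x_def by (simp add: algebra_simps power2_eq_square)
  then have "x - 4 \<le> 6 * F" unfolding F by presburger
  then have "real_of_int (x - 4) \<le> real_of_int (6 * F)" by (simp only: of_int_le_iff)
  then show "3 * (real r)\<^sup>2 - real r - 8 \<le> 6 * real_of_int F" by (simp add: x_def)
  show "r = 3 \<Longrightarrow> F = 3" "r = 4 \<Longrightarrow> F = 6" "r = 5 \<Longrightarrow> F = 11" "r = 6 \<Longrightarrow> F = 16"
    by (simp_all add: F x_def)
qed

text \<open>Substituting \<open>\<tau> = 2 + \<phi> * M\<close> into the quadratic from
  \<open>avg_link_degree_ineq\<close> with \<open>p = q\<close> leaves \<open>M\<close> times this
  expression. For \<open>r = 4\<close> it is \<open>0.24 M - 0.8\<close>, which is negative at
  \<open>M = 2\<close> and \<open>M = 3\<close>; hence the extra assumption.\<close>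

lemma quadratic_threshold:
  fixes r :: nat and F :: int and M :: real
  assumes r: "r \<ge> 3" and M: "M \<ge> 2" and M4: "r = 4 \<Longrightarrow> M \<ge> 4"
    and F: "F = \<lfloor>(real r + 1) * (3 * real r - 4) / 6\<rfloor>"
    and \<phi>: "\<phi> = 2 * real_of_int F / (real r * (real r + 1))"
  shows "0 \<le> 3 * real r * \<phi> - 3 * real r + 4 + M * \<phi> * (real r * \<phi> - real r + 2)"
proof -
  consider "r = 3" | "r = 4" | "r = 5" | "r = 6" | "r \<ge> 7" using r by linarith
  then show ?thesis
  proof cases
    case 5
    \<comment> \<open>With \<open>\<delta> = R * \<phi> - R + 2\<close> the goal reads
      \<open>3 \<delta> - 2 + M * \<phi> * \<delta> \<ge> 0\<close>. The lower bound for
      \<open>\<delta>\<close> makes \<open>3 \<delta> - 2\<close> at least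
      \<open>- 4 / (R + 1)\<close>, and \<open>\<phi> \<ge> 3 / (R - 1)\<close> with
      \<open>M \<ge> 2\<close> compensates exactly that.\<close>
    define R where "R = real r"
    have R: "R \<ge> 7" using 5 by (simp add: R_def)
    have F6: "3 * R\<^sup>2 - R - 8 \<le> 6 * real_of_int F"
      using floor_ceiling_coefficients(2)[OF r] by (simp add: F R_def)
    have R\<phi>: "R * \<phi> = 6 * real_of_int F / (3 * (R + 1))"
      using R by (simp add: \<phi> divide_simps flip: R_def)
    have "(3 * R\<^sup>2 - R - 8) / (3 * (R + 1)) \<le> R * \<phi>"
      unfolding R\<phi> using R F6 by (intro divide_right_mono) auto
    moreover have "(3 * R\<^sup>2 - R - 8) / (3 * (R + 1)) = R - 2 + 2 * (R - 1) / (3 * (R + 1))"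
      using R by (simp add: field_simps power2_eq_square)
    ultimately have gap: "R * \<phi> - R + 2 \<ge> 2 * (R - 1) / (3 * (R + 1))" by simp
    \<comment> \<open>This is the difference of the two sides of the next inequality, divided by
      \<open>R - 7\<close> with remainder 288.\<close>
    have "0 \<le> (R - 7) * (3 * R\<^sup>2 + 8 * R + 40) + 288"
      using R by (intro add_nonneg_nonneg mult_nonneg_nonneg) auto
    then have "9 * R * (R + 1) \<le> (3 * R\<^sup>2 - R - 8) * (R - 1)"
      by (simp add: algebra_simps power2_eq_square)
    also have "\<dots> \<le> 6 * real_of_int F * (R - 1)"
      using F6 R by (intro mult_right_mono) auto
    finally have "3 * (R * (R + 1)) \<le> 2 * real_of_int F * (R - 1)" by simp
    then have "3 / (R - 1) \<le> 2 * real_of_int F / (R * (R + 1))"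
      using R by (simp add: frac_le_eq divide_nonpos_pos)
    then have "3 / (R - 1) \<le> \<phi>" by (simp add: \<phi> R_def)
    then have M\<phi>: "2 * (3 / (R - 1)) \<le> M * \<phi>"
      using M R by (intro mult_mono) auto
    have "0 \<le> 2 * (3 / (R - 1))" using R by simp
    with M\<phi> have "0 \<le> M * \<phi>" by linarith
    then have "(2 * (3 / (R - 1))) * (2 * (R - 1) / (3 * (R + 1))) \<le> M * \<phi> * (R * \<phi> - R + 2)"
      using R by (intro mult_mono[OF M\<phi> gap]) auto
    moreover have "(2 * (3 / (R - 1))) * (2 * (R - 1) / (3 * (R + 1))) = 4 / (R + 1)"
      using R by (simp add: divide_simps) (simp add: algebra_simps)
    ultimately have lower: "4 / (R + 1) \<le> M * \<phi> * (R * \<phi> - R + 2)" by simp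
    have "2 * (R - 1) / (3 * (R + 1)) * 3 = 2 - 4 / (R + 1)"
      using R by (simp add: divide_simps) (simp add: algebra_simps)
    with mult_right_mono[OF gap, of 3] have "2 - 4 / (R + 1) \<le> 3 * (R * \<phi> - R + 2)"
      by (simp only: mult.commute[of _ 3])
    then have "0 \<le> 3 * (R * \<phi> - R + 2) - 2 + M * \<phi> * (R * \<phi> - R + 2)"
      using lower by linarith
    then show ?thesis by (simp add: R_def algebra_simps)
  next
    case 1
    then have \<phi>_eq: "\<phi> = 1 / 2" using floor_ceiling_coefficients(3)[OF r] by (simp add: \<phi> F)
    show ?thesis unfolding \<phi>_eq using 1 M by simp
  next
    case 2
    then have \<phi>_eq: "\<phi> = 3 / 5" using floor_ceiling_coefficients(4)[OF r] by (simp add: \<phi> F)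
    show ?thesis unfolding \<phi>_eq using 2 M4 by simp
  next
    case 3
    then have \<phi>_eq: "\<phi> = 11 / 15" using floor_ceiling_coefficients(5)[OF r] by (simp add: \<phi> F)
    show ?thesis unfolding \<phi>_eq using 3 M by simp
  next
    case 4
    then have \<phi>_eq: "\<phi> = 16 / 21" using floor_ceiling_coefficients(6)[OF r] by (simp add: \<phi> F)
    show ?thesis unfolding \<phi>_eq using 4 M by simp
  qed
qed

theorem theorem10:
  fixes r n :: nat and H H' :: "'a hypergraph"
  assumes "r \<ge> 3"
    and "friendship_hypergraph r H"
    and "card (verts H) = n"
    and "H' = clique_decomposition r H"
  shows "real (card (hyperedges H')) \<le>
    2 / (real r * (real r + 1)\<^sup>2)
      * real_of_int \<lfloor>(real r + 1) * (3 * real r - 4) / 6\<rfloor> * real (n choose r)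
    + 4 / ((real r)\<^sup>2 * (real r + 1)\<^sup>2)
      * real_of_int \<lceil>2 * (real r + 1) / 3\<rceil> * real (n choose (r - 1))"
proof -
  interpret friendship r H using assms by unfold_locales auto
  define F G where "F = \<lfloor>(real r + 1) * (3 * real r - 4) / 6\<rfloor>"
    and "G = \<lceil>2 * (real r + 1) / 3\<rceil>"
  note FG = floor_ceiling_coefficients[OF assms(1), folded F_def G_def]
  have F0: "F \<ge> 0" and G0: "G \<ge> 0"
    using assms(1) by (auto simp: F_def G_def intro!: divide_nonneg_pos mult_nonneg_nonneg)
  show ?thesis
  proof (cases "n \<le> r")
    case True
    have "blocks = {}"
    proof (rule equals0I)
      fix S assume "S \<in> blocks"
      then have "S \<subseteq> verts H" "card S = Suc r"
        using blocks_subset subsets_of_sizeD[OF finite_verts] by blast+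
      then show False using card_mono[OF finite_verts, of S] True assms(3) by simp
    qed
    then have "card (hyperedges H') = 0" using assms(4) by simp
    then show ?thesis
      unfolding F_def[symmetric] G_def[symmetric] using F0 G0
      by (simp only: of_nat_0) (intro add_nonneg_nonneg mult_nonneg_nonneg; simp)
  next
    case False
    \<comment> \<open>\<open>M + 2\<close> is the number of vertices outside an
      \<open>(r - 1)\<close>-set, hence the largest possible link degree. Since the number of blocks
      is \<open>s * D / (R * (R + 1))\<close>, the theorem amounts to
      \<open>s \<le> 2 + \<phi> * M\<close>.\<close>
    define R M \<phi> s D where "R = real r" and "M = real n - R - 1"
      and "\<phi> = 2 * real_of_int F / (real r * (real r + 1))" and "s = avg_link_degree"
      and "D = real (n choose (r - 1))"
    have R: "R \<ge> 3" and M: "M \<ge> 0" using assms(1) False by (auto simp: R_def M_def)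
    have \<phi>0: "\<phi> \<ge> 0" using F0 by (simp add: \<phi>_def)
    have D: "D > 0" using False by (simp add: D_def)
    have deg: "even (link_degree (verts H) (hyperedges H) C)"
      "real (link_degree (verts H) (hyperedges H) C) \<le> M + 2"
      if "C \<in> subsets_of_size (verts H) (r - 1)" for C
      using even_link_degree[OF that] link_degree_le[OF that] assms(1,3) False
      by (auto simp: M_def R_def)
    have nr: "card (verts H) \<ge> r" using False assms(3) by simp
    have m: "real (card (verts H)) - real r + 1 = M + 2" using assms(3) by (simp add: M_def R_def)
    note ineq = avg_link_degree_ineq[OF nr, unfolded m, folded R_def s_def]
    have "s \<le> 2 + \<phi> * M"
    proof -
      consider "n \<le> r + 2" | "r = 4" "n = 7 \<or> n = 8"
        | "n \<ge> r + 3" "r = 4 \<Longrightarrow> n \<ge> 9" by linarith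
      then show ?thesis
      proof cases
        case 1
        \<comment> \<open>At most three vertices lie outside \<open>C\<close>, and evenness excludes
          degree 3.\<close>
        have "real (link_degree (verts H) (hyperedges H) C) \<le> 2"
          if C: "C \<in> subsets_of_size (verts H) (r - 1)" for C
        proof -
          have "link_degree (verts H) (hyperedges H) C \<le> 3"
            using deg(2)[OF C] 1 by (simp add: M_def R_def)
          then show ?thesis using deg(1)[OF C]
            by (cases "link_degree (verts H) (hyperedges H) C = 3") auto
        qed
        then have "s \<le> 2" unfolding s_def by (rule avg_link_degree_le[OF nr])
        then show ?thesis using \<phi>0 M by (simp add: add_increasing2)
      next
        case 3
        define \<tau> where "\<tau> = 2 + \<phi> * M"
        have "M \<ge> 2" "r = 4 \<Longrightarrow> M \<ge> 4" using 3 by (auto simp: M_def R_def)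
        then have "0 \<le> 3 * R * \<phi> - 3 * R + 4 + M * \<phi> * (R * \<phi> - R + 2)"
          using quadratic_threshold[OF assms(1) _ _ F_def \<phi>_def] by (simp add: R_def)
        then have "0 \<le> M * (3 * R * \<phi> - 3 * R + 4 + M * \<phi> * (R * \<phi> - R + 2))"
          using M by simp
        then have Q: "((R - 2) * (M + 2) - R + 4) * \<tau> + R * (M + 2) \<le> R * \<tau> * \<tau>"
          by (simp add: \<tau>_def algebra_simps)
        let ?L = "(R - 2) * (M + 2) - R + 4"
        have \<tau>: "\<tau> > 0" using \<phi>0 M by (simp add: \<tau>_def add_pos_nonneg)
        have "R * (M + 2) > 0" using R M by simp
        \<comment> \<open>\<open>L < R * \<tau>\<close> makes the coefficient
          \<open>2 * R * \<tau> - L\<close> positive, so it can be cancelled once \<open>Q\<close>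
          is combined with the tangent inequality at \<open>\<tau>\<close>.\<close>
        with Q have "?L * \<tau> < R * \<tau> * \<tau>" by linarith
        then have L: "?L < R * \<tau>" using \<tau> by (simp add: mult_less_cancel_right)
        have "R * ((\<tau> + \<tau>) * s - \<tau> * \<tau>) \<le> ?L * s + R * (M + 2)"
          by (rule ineq) simp
        with Q have "(2 * R * \<tau> - ?L) * s \<le> (2 * R * \<tau> - ?L) * \<tau>"
          by (simp add: algebra_simps)
        moreover have "2 * R * \<tau> - ?L > 0" using L R \<tau> mult_pos_pos[of R \<tau>] by linarith
        ultimately show ?thesis unfolding \<tau>_def by (simp add: mult_le_cancel_left)
      next
        case small: 2
        \<comment> \<open>Here the tangent bound is too weak; evenness of the link degrees improves it.\<close>
        have "R * ((2 + 4) * s - 2 * 4) \<le> ((R - 2) * (M + 2) - R + 4) * s + R * (M + 2)"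
          by (intro ineq even_imp_two_four_product_nonneg deg)
        \<comment> \<open>The inequality gives \<open>s \<le> 3\<close> for \<open>n = 7\<close> and
          \<open>s \<le> 26 / 7\<close> for \<open>n = 8\<close>, against the required
          \<open>3.2\<close> and \<open>3.8\<close>.\<close>
        then show ?thesis using small FG(4) by (auto simp add: R_def M_def \<phi>_def)
      qed
    qed
    then have "real (card blocks) * (R * (R + 1)) \<le> (2 + \<phi> * M) * D"
      using D by (simp add: s_def avg_link_degree_def assms(3) card_edges R_def D_def
          pos_divide_le_eq algebra_simps)
    then have "real (card blocks) \<le> (2 + \<phi> * M) * D / (R * (R + 1))"
      using R by (intro mult_imp_le_div_pos) auto
    \<comment> \<open>\<open>FG(1)\<close> rewrites \<open>R * (R + 1)\<close> as
      \<open>2 (F + G)\<close>, splitting the constant 2 of the bound into an \<open>F\<close> part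
      and a \<open>G\<close> part. The \<open>F\<close> part joins \<open>2 * F * M\<close> to form
      \<open>2 * F * (M + 2)\<close>, where \<open>M + 2\<close> is the factor that turns
      \<open>D\<close> into \<open>R\<close> times \<open>n choose r\<close>.\<close>
    also have "\<dots> = (2 * (2 * (real_of_int F + real_of_int G)) + 2 * real_of_int F * M) * D
        / (R * (R + 1))\<^sup>2"
      unfolding FG(1) \<phi>_def R_def[symmetric] using R
      by (simp add: divide_simps power2_eq_square)
    also have "\<dots> = 2 / (R * (R + 1)\<^sup>2) * real_of_int F * ((M + 2) * D / R)
        + 4 / (R\<^sup>2 * (R + 1)\<^sup>2) * real_of_int G * D"
      using R by (simp add: divide_simps power2_eq_square) (simp add: algebra_simps)
    also have "(M + 2) * D / R = real (n choose r)"
      using choose_absorb_pred[OF rank_pos nr, unfolded m] R by (simp add: R_def D_def assms(3) field_simps)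
    finally show ?thesis by (simp add: F_def G_def R_def D_def assms(4))
  qed
qed

end
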